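(* Let $\Omega\subset\mathbb{R}^2$ be a bounded simply connected domain with smooth boundary, let $\theta\in C^2(\overline\Omega)$ be real valued, and let $\Omega$ be divided into two measurable phases with indicator functions $\chi_1,\chi_2$ ($\chi_1+\chi_2=1$) and volume fractions $f_j=\frac{1}{|\Omega|}\int_\Omega\chi_j\in(0,1)$, $j=1,2$. Let $\lambda=\lambda_1\chi_1+\lambda_2\chi_2$ and $\mu=\mu_1\chi_1+\mu_2\chi_2$ with constants $\lambda_j,\mu_j\in\mathbb{R}$ satisfying $\mu_j>0$ and $2\mu_j+3\lambda_j>0$ for $j=1,2$. Put $$\alpha_j=\frac{\lambda_j+2\mu_j}{4\mu_j(2\mu_j+3\lambda_j)},\quad \beta_j=\frac1{4\mu_j},\quad \tilde\alpha_j=\frac{4\mu_j(3\lambda_j+2\mu_j)}{3(\lambda_j+2\mu_j)},\quad \tilde\beta_j=\frac{4\mu_j}{3},$$ and assume $\alpha_1\neq\alpha_2$ and $\beta_1\ne\beta_2$. Let $$\alpha_*=\min\{\alpha_1,\alpha_2\},\ \beta_*=\min\{\beta_1,\beta_2\},\ \tilde\alpha_*=\min\{\tilde\alpha_1,\tilde\alpha_2\},\ \tilde\beta_*=\min\{\tilde\beta_1,\tilde\beta_2\}.$$ Let $\mathbf u=(\mathbf u',u_3)=(u_1,u_2,u_3):\Omega\to\mathbb{R}^3$, with $\mathbf u'\in H^1(\Omega;\mathbb{R}^2)$ and $u_3\in H^2(\Omega)$, be a weak solution of the two-phase shallow shell equations $$\operatorname{div}\mathbf s^\theta=0,\qquad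 \operatorname{div}\operatorname{div}\mathbf m-\operatorname{div}(\mathbf s^\theta\nabla\theta)=0\qquad\text{in }\Omega,$$ where $$\mathbf m=\frac{4\mu}{3}\nabla^2u_3+\frac{4\lambda\mu}{3(\lambda+2\mu)}(\operatorname{Tr}\nabla^2u_3)I_2,\qquad \mathbf s^\theta=4\mu\,\mathbf e^\theta+\frac{4\lambda\mu}{\lambda+2\mu}(\operatorname{Tr}\mathbf e^\theta)I_2,$$ $$\mathbf e^\theta=\tfrac12\left(\nabla\mathbf u'+(\nabla\mathbf u')^T+\nabla\theta\otimes\nabla u_3+(\nabla\theta\otimes\nabla u_3)^T\right).$$ Let $\psi\in H^2(\Omega)$ be a function (which exists and is unique up to adding an affine function) such that $$\mathbf s^\theta=\begin{pmatrix}\psi_{,22}&-\psi_{,12}\\-\psi_{,12}&\psi_{,11}\end{pmatrix}.$$ With the tensors $\mathbb L,\mathbb M$, the $3\times3$ matrices $L_j,M_j,T,S_j,\tilde S_j$, the averages $\langle\cdot\rangle$, and the identification of symmetric $2\times2$ matrices with vectors of $\mathbb{R}^3$ given in the context, set $$e_0=\langle\mathbb L\nabla^2\psi\cdot\nabla^2\psi\rangle+\langle\mathbb M\nabla^2u_3\cdot\nabla^2u_3\rangle,$$ $$a_0=\langle\nabla^2\psi\rangle,\quad b_0=\langle\mathbb L\nabla^2\psi\rangle,\quad c_0=\langle\det\nabla^2\psi\rangle,\qquad \tilde a_0=\langle\nabla^2u_3\rangle,\quad \tilde b_0=\langle\mathbb M\nabla^2u_3\rangle,\quad \tilde c_0=\langle\det\nabla^2u_3\rangle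 .$$ Then for all $\zeta\in(-\beta_*,\alpha_* )$ and all $\tilde\zeta\in(-\tilde\beta_*,\tilde\alpha_* )$, $$\begin{aligned} e_0-b_0\cdot a_0-\tilde b_0\cdot\tilde a_0\ \ge\ &\zeta\left\{\frac{(S_1-S_2)^{-2}}{f_1f_2}[b_0-\langle L\rangle a_0]\cdot[\langle L\rangle Ta_0-Tb_0]+2c_0-2\det a_0\right\}\\ &+\frac{(S_1-S_2)^{-2}}{f_1f_2}[b_0-\langle L\rangle a_0]\cdot[(f_2L_1+f_1L_2)b_0-L_1L_2a_0]\\ &+\tilde\zeta\left\{\frac{(\tilde S_1-\tilde S_2)^{-2}}{f_1f_2}[\tilde b_0-\langle M\rangle\tilde a_0]\cdot[\langle M\rangle T\tilde a_0-T\tilde b_0]+2\tilde c_0-2\det\tilde a_0\right\}\\ &+\frac{(\tilde S_1-\tilde S_2)^{-2}}{f_1f_2}[\tilde b_0-\langle M\rangle\tilde a_0]\cdot[(f_2M_1+f_1M_2)\tilde b_0-M_1M_2\tilde a_0]. \end{aligned}$$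
   Context: Notation. $I_2$ is the $2\times2$ identity matrix, $\mathbf a\otimes\mathbf b$ is the tensor product of vectors, subscripts after a comma denote partial derivatives, $\nabla^2$ is the Hessian, and the divergence of a matrix field is taken row-wise. For a field $f$ on $\Omega$, $\langle f\rangle=\frac1{|\Omega|}\int_\Omega f$ (entrywise for matrix-valued fields). For symmetric $2\times 2$ matrices, $A\cdot B=\operatorname{Tr}(A^TB)$. Fourth order tensors. For a symmetric $2\times2$ matrix $A$, $$\mathbb LA=\frac1{4\mu}A-\frac{\lambda}{4\mu(3\lambda+2\mu)}(\operatorname{Tr}A)I_2,\qquad \mathbb MA=\frac{4\mu}{3}A+\frac{4\lambda\mu}{3(\lambda+2\mu)}(\operatorname{Tr}A)I_2 .$$ These depend on $x\in\Omega$ through $\lambda(x),\mu(x)$. Identification with $\mathbb{R}^3$. A symmetric matrix $A=\begin{pmatrix} a_{11} & a_{12} \\ a_{12} & a_{22} \end{pmatrix}$ is identified with the vector $\mathbf v=\frac1{\sqrt2}(a_{11}+a_{22},\,a_{11}-a_{22},\,2a_{12})^T$, i.e. its coordinates in the orthonormal basis $\frac1{\sqrt2}\begin{pmatrix}1&0\\0&1\end{pmatrix},\ \frac1{\sqrt2}\begin{pmatrix}1&0\\0&-1\end{pmatrix},\ \frac1{\sqrt2}\begin{pmatrix}0&1\\1&0\end{pmatrix}$. The product $A\cdot B$ becomes the Euclidean inner product of $\mathbb{R}^3$, and $\det A=\frac12\mathbf v\cdot T\mathbf v$ with $T=\operatorname{diag}(1,-1,-1)$. Under this identification, in phase $j$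 the tensors $\mathbb L,\mathbb M$ are the matrices $$L_j=\operatorname{diag}(\alpha_j,\beta_j,\beta_j),\qquad M_j=\operatorname{diag}(\tilde\alpha_j,\tilde\beta_j,\tilde\beta_j),\qquad j=1,2.$$ In the inequality, $a_0,b_0,\tilde a_0,\tilde b_0$ are regarded as vectors in $\mathbb{R}^3$ in this way ($\det a_0$, $\det\tilde a_0$ being the determinants of the corresponding $2\times2$ matrices). Moreover $\langle L\rangle=f_1L_1+f_2L_2$, $\langle M\rangle=f_1M_1+f_2M_2$, and $$S_j=L_j-\zeta T,\qquad \tilde S_j=M_j-\tilde\zeta T,\qquad j=1,2.$$ The expression $\frac{(S_1-S_2)^{-2}}{f_1f_2}[x]\cdot[y]$ means $\frac1{f_1f_2}\left((S_1-S_2)^{-2}x\right)\cdot y$ for $x,y\in\mathbb{R}^3$, and similarly with $\tilde S_j$. *)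

theory Defs
  imports "HOL-Analysis.Analysis"
begin

section \<open>Classical derivatives, smooth functions, smooth domains\<close>

definition dir_deriv :: "'a::real_normed_vector \<Rightarrow> ('a \<Rightarrow> real) \<Rightarrow> 'a \<Rightarrow> real" where
  "dir_deriv v f x = frechet_derivative f (at x) v"

text \<open>All iterated directional derivatives exist and are Frechet differentiable everywhere;
  this is the class of infinitely differentiable functions on the whole space.\<close>

definition smooth :: "('a::real_normed_vector \<Rightarrow> real) \<Rightarrow> bool" where
  "smooth f \<longleftrightarrow> (\<forall>vs x. fold dir_deriv vs f differentiable (at x))"

definition partial :: "2 \<Rightarrow> (real^2 \<Rightarrow> real) \<Rightarrow> real^2 \<Rightarrow> real" where
  "partial i = dir_deriv (axis i 1)"

definition grad :: "(real^2 \<Rightarrow> real) \<Rightarrow> real^2 \<Rightarrow> real^2" where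
  "grad f x = (\<chi> i. partial i f x)"

definition hess :: "(real^2 \<Rightarrow> real) \<Rightarrow> real^2 \<Rightarrow> real^2^2" where
  "hess f x = (\<chi> i j. partial j (partial i f) x)"

text \<open>Near each boundary point, after an orthogonal change of coordinates, the domain is the
  region strictly above the graph of a smooth function of one variable.\<close>

definition smooth_boundary :: "(real^2) set \<Rightarrow> bool" where
  "smooth_boundary \<Omega> \<longleftrightarrow>
     (\<forall>p\<in>frontier \<Omega>. \<exists>(Q :: real^2 \<Rightarrow> real^2) (\<gamma> :: real \<Rightarrow> real) r.
        orthogonal_transformation Q \<and> smooth \<gamma> \<and> r > 0 \<and>
        (\<forall>x\<in>ball p r. x \<in> \<Omega> \<longleftrightarrow> \<gamma> (Q x $ 1) < Q x $ 2))"

text \<open>The function and its derivatives of order one and two on the open set extend continuously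
  to the closure; only the values of the function on the closure matter.\<close>

definition C2_closure :: "(real^2) set \<Rightarrow> (real^2 \<Rightarrow> real) \<Rightarrow> bool" where
  "C2_closure \<Omega> \<theta> \<longleftrightarrow>
     (\<exists>(g :: real^2 \<Rightarrow> real^2) (H :: real^2 \<Rightarrow> real^2^2).
        continuous_on (closure \<Omega>) \<theta> \<and> continuous_on (closure \<Omega>) g \<and> continuous_on (closure \<Omega>) H \<and>
        (\<forall>x\<in>\<Omega>. (\<theta> has_derivative (\<lambda>h. g x \<bullet> h)) (at x) \<and>
                (g has_derivative (\<lambda>h. H x *v h)) (at x)))"

section \<open>Sobolev spaces\<close>

definition test_functions :: "(real^2) set \<Rightarrow> (real^2 \<Rightarrow> real) set" where
  "test_functions \<Omega> =
     {\<phi>. smooth \<phi> \<and> compact (closure {x. \<phi> x \<noteq> 0}) \<and> closure {x. \<phi> x \<noteq> 0} \<subseteq> \<Omega>}"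

definition L2 :: "(real^2) set \<Rightarrow> (real^2 \<Rightarrow> real) set" where
  "L2 \<Omega> = {f. f \<in> borel_measurable (lebesgue_on \<Omega>) \<and> integrable (lebesgue_on \<Omega>) (\<lambda>x. (f x)\<^sup>2)}"

text \<open>A pair of naturals is a multi-index in two variables.\<close>

definition multi_partial :: "nat \<times> nat \<Rightarrow> (real^2 \<Rightarrow> real) \<Rightarrow> real^2 \<Rightarrow> real" where
  "multi_partial \<kappa> \<phi> = (partial 1 ^^ fst \<kappa>) ((partial 2 ^^ snd \<kappa>) \<phi>)"

definition has_weak_deriv ::
    "(real^2) set \<Rightarrow> nat \<times> nat \<Rightarrow> (real^2 \<Rightarrow> real) \<Rightarrow> (real^2 \<Rightarrow> real) \<Rightarrow> bool" where
  "has_weak_deriv \<Omega> \<kappa> f g \<longleftrightarrow>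
     (\<forall>\<phi>\<in>test_functions \<Omega>.
        (\<integral>x. f x * multi_partial \<kappa> \<phi> x \<partial>lebesgue_on \<Omega>) =
        (-1) ^ (fst \<kappa> + snd \<kappa>) * (\<integral>x. g x * \<phi> x \<partial>lebesgue_on \<Omega>))"

definition sobolev_H :: "nat \<Rightarrow> (real^2) set \<Rightarrow> (real^2 \<Rightarrow> real) set" where
  "sobolev_H k \<Omega> =
     {f \<in> L2 \<Omega>. \<forall>\<kappa>. fst \<kappa> + snd \<kappa> \<le> k \<longrightarrow> (\<exists>g\<in>L2 \<Omega>. has_weak_deriv \<Omega> \<kappa> f g)}"

text \<open>A representative of the weak derivative, which is determined almost everywhere.
  Meaningful only when such a derivative exists in \<open>L2 \<Omega>\<close>.\<close>

definition weak_deriv :: "(real^2) set \<Rightarrow> nat \<times> nat \<Rightarrow> (real^2 \<Rightarrow> real) \<Rightarrow> real^2 \<Rightarrow> real" where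
  "weak_deriv \<Omega> \<kappa> f = (SOME g. g \<in> L2 \<Omega> \<and> has_weak_deriv \<Omega> \<kappa> f g)"

definition wgrad :: "(real^2) set \<Rightarrow> (real^2 \<Rightarrow> real) \<Rightarrow> real^2 \<Rightarrow> real^2" where
  "wgrad \<Omega> f x = vector [weak_deriv \<Omega> (1,0) f x, weak_deriv \<Omega> (0,1) f x]"

definition wjacobian :: "(real^2) set \<Rightarrow> (real^2 \<Rightarrow> real^2) \<Rightarrow> real^2 \<Rightarrow> real^2^2" where
  "wjacobian \<Omega> v x = (\<chi> i. wgrad \<Omega> (\<lambda>y. v y $ i) x)"

definition whess :: "(real^2) set \<Rightarrow> (real^2 \<Rightarrow> real) \<Rightarrow> real^2 \<Rightarrow> real^2^2" where
  "whess \<Omega> f x = vector [vector [weak_deriv \<Omega> (2,0) f x, weak_deriv \<Omega> (1,1) f x],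
                         vector [weak_deriv \<Omega> (1,1) f x, weak_deriv \<Omega> (0,2) f x]]"

section \<open>Averages, matrices and tensors\<close>

definition avg :: "(real^2) set \<Rightarrow> (real^2 \<Rightarrow> 'b::{banach,second_countable_topology}) \<Rightarrow> 'b" where
  "avg \<Omega> f = (1 / measure lebesgue \<Omega>) *\<^sub>R (\<integral>x. f x \<partial>lebesgue_on \<Omega>)"

definition outer :: "real^2 \<Rightarrow> real^2 \<Rightarrow> real^2^2" where
  "outer a b = (\<chi> i j. a $ i * b $ j)"

definition mat_dot :: "real^2^2 \<Rightarrow> real^2^2 \<Rightarrow> real" where
  "mat_dot A B = trace (transpose A ** B)"

definition tensor_L :: "real \<Rightarrow> real \<Rightarrow> real^2^2 \<Rightarrow> real^2^2" where
  "tensor_L lam mu A =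
     (1 / (4 * mu)) *\<^sub>R A - (lam / (4 * mu * (3 * lam + 2 * mu)) * trace A) *\<^sub>R mat 1"

definition tensor_M :: "real \<Rightarrow> real \<Rightarrow> real^2^2 \<Rightarrow> real^2^2" where
  "tensor_M lam mu A =
     (4 * mu / 3) *\<^sub>R A + (4 * lam * mu / (3 * (lam + 2 * mu)) * trace A) *\<^sub>R mat 1"

text \<open>Coordinates of a symmetric matrix in the orthonormal basis consisting of
  the matrices \<open>diag(1,1)\<close>, \<open>diag(1,-1)\<close> and \<open>((0,1),(1,0))\<close>, each divided by \<open>sqrt 2\<close>.\<close>

definition sym_vec :: "real^2^2 \<Rightarrow> real^3" where
  "sym_vec A = (1 / sqrt 2) *\<^sub>R vector [A$1$1 + A$2$2, A$1$1 - A$2$2, 2 * A$1$2]"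

definition diag3 :: "real \<Rightarrow> real \<Rightarrow> real \<Rightarrow> real^3^3" where
  "diag3 a b c = vector [vector [a, 0, 0], vector [0, b, 0], vector [0, 0, c]]"

definition mat_T :: "real^3^3" where
  "mat_T = diag3 1 (-1) (-1)"

definition mat_inv_sq :: "real^3^3 \<Rightarrow> real^3^3" where
  "mat_inv_sq A = matrix_inv A ** matrix_inv A"

section \<open>Shallow shell equations\<close>

text \<open>The two phases are indexed by the two-element type \<^typ>\<open>2\<close>, with elements 1 and 2.\<close>

definition piecewise_const :: "(2 \<Rightarrow> (real^2) set) \<Rightarrow> (2 \<Rightarrow> real) \<Rightarrow> real^2 \<Rightarrow> real" where
  "piecewise_const P c x = c 1 * indicat_real (P 1) x + c 2 * indicat_real (P 2) x"

definition shell_strain ::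
    "(real^2) set \<Rightarrow> (real^2 \<Rightarrow> real) \<Rightarrow> (real^2 \<Rightarrow> real^2) \<Rightarrow> (real^2 \<Rightarrow> real) \<Rightarrow> real^2 \<Rightarrow> real^2^2" where
  "shell_strain \<Omega> \<theta> u' u3 x =
     (1/2) *\<^sub>R (wjacobian \<Omega> u' x + transpose (wjacobian \<Omega> u' x)
              + outer (grad \<theta> x) (wgrad \<Omega> u3 x) + transpose (outer (grad \<theta> x) (wgrad \<Omega> u3 x)))"

definition stress_of_strain :: "real \<Rightarrow> real \<Rightarrow> real^2^2 \<Rightarrow> real^2^2" where
  "stress_of_strain lam mu e =
     (4 * mu) *\<^sub>R e + (4 * lam * mu / (lam + 2 * mu) * trace e) *\<^sub>R mat 1"

text \<open>Weak form of \<open>div s = 0\<close> and \<open>div div m - div (s grad \<theta>) = 0\<close>, obtained by testing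
  with smooth compactly supported functions and integrating by parts (twice for \<open>m\<close>).\<close>

definition weak_shell_equations ::
    "(real^2) set \<Rightarrow> (real^2 \<Rightarrow> real) \<Rightarrow> (real^2 \<Rightarrow> real^2^2) \<Rightarrow> (real^2 \<Rightarrow> real^2^2) \<Rightarrow> bool" where
  "weak_shell_equations \<Omega> \<theta> s m \<longleftrightarrow>
     (\<forall>\<phi>\<in>test_functions \<Omega>. \<forall>i. (\<integral>x. (s x *v grad \<phi> x) $ i \<partial>lebesgue_on \<Omega>) = 0) \<and>
     (\<forall>\<phi>\<in>test_functions \<Omega>.
        (\<integral>x. mat_dot (m x) (hess \<phi> x) + (s x *v grad \<theta> x) \<bullet> grad \<phi> x \<partial>lebesgue_on \<Omega>) = 0)"

end

theory Submission
  imports Defs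
begin

text \<open>
  This is the translation method. The term of the inequality in \<open>\<psi>\<close> and the term in
  \<open>u\<^sub>3\<close> do not interact: each is an inequality about a single field \<open>A\<close> of
  symmetric matrices with square integrable entries and a two-phase tensor \<open>C\<close> (once the
  Hessian of \<open>\<psi>\<close> with \<open>L\<close>, once the Hessian of \<open>u\<^sub>3\<close> with
  \<open>M\<close>), and the theorem is the sum of the two.

  For one field, subtract from the energy density \<open>C A \<cdot> A\<close> the multiple
  \<open>2 \<zeta> det A = \<zeta> T A \<cdot> A\<close> of the determinant, whose average is the given number
  \<open>c\<^sub>0\<close>. The range of \<open>\<zeta>\<close> is exactly the one in which the translated
  matrices \<open>S\<^sub>j = L\<^sub>j - \<zeta> T\<close> of both phases stay positive definite, so
  Cauchy-Schwarz in each phase bounds the translated energy from below by its value on the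
  field that is constant in each phase with the same phase averages
  \<open>A\<^sub>1, A\<^sub>2\<close>. These two averages are determined by
  \<open>a = f\<^sub>1 A\<^sub>1 + f\<^sub>2 A\<^sub>2\<close> and
  \<open>b = f\<^sub>1 L\<^sub>1 A\<^sub>1 + f\<^sub>2 L\<^sub>2 A\<^sub>2\<close>, because
  \<open>L\<^sub>1 - L\<^sub>2 = S\<^sub>1 - S\<^sub>2\<close> is invertible. Eliminating them gives the
  right-hand side of the theorem.

  In the orthonormal basis of symmetric matrices every matrix involved is diagonal, so all of
  this happens one coordinate at a time. The scalar inequality is
  \<open>translation_bound_coordinate\<close>, resting on \<open>phase_cauchy_schwarz\<close> and on the
  elimination \<open>translation_identity\<close>; \<open>translation_bound_vector\<close> adds up the three
  coordinates, and \<open>translation_bound_symmetric\<close> returns to matrices.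

  The contrast between the phases assumed for \<open>L\<close> carries over to \<open>M\<close>, since the
  eigenvalues of the two tensors satisfy \<open>3 \<alpha> \<alpha>t = 3 \<beta> \<beta>t = 1\<close>.
\<close>

section \<open>Square integrable functions and averages\<close>

lemma L2_add:
  assumes "f \<in> L2 \<Omega>" "g \<in> L2 \<Omega>"
  shows "(\<lambda>x. f x + g x) \<in> L2 \<Omega>"
proof -
  have [measurable]: "f \<in> borel_measurable (lebesgue_on \<Omega>)" "g \<in> borel_measurable (lebesgue_on \<Omega>)"
    using assms by (auto simp: L2_def)
  have dom: "integrable (lebesgue_on \<Omega>) (\<lambda>x. 2 * (f x)\<^sup>2 + 2 * (g x)\<^sup>2)"
    using assms by (auto simp: L2_def)
  have "(f x + g x)\<^sup>2 \<le> 2 * (f x)\<^sup>2 + 2 * (g x)\<^sup>2" for x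
    using zero_le_power2[of "f x - g x"] by (simp add: power2_eq_square algebra_simps)
  then have "integrable (lebesgue_on \<Omega>) (\<lambda>x. (f x + g x)\<^sup>2)"
    by (intro Bochner_Integration.integrable_bound[OF dom]) auto
  then show ?thesis
    by (simp add: L2_def)
qed

lemma L2_cmult:
  assumes "f \<in> L2 \<Omega>"
  shows "(\<lambda>x. c * f x) \<in> L2 \<Omega>"
  using assms by (auto simp: L2_def power_mult_distrib)

lemma L2_diff:
  assumes "f \<in> L2 \<Omega>" "g \<in> L2 \<Omega>"
  shows "(\<lambda>x. f x - g x) \<in> L2 \<Omega>"
  using L2_add[OF assms(1) L2_cmult[OF assms(2), of "-1"]] by simp

lemma L2_integrable:
  assumes "\<Omega> \<in> lmeasurable" "f \<in> L2 \<Omega>"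
  shows "integrable (lebesgue_on \<Omega>) f"
proof -
  interpret finite_measure "lebesgue_on \<Omega>"
    using assms(1) by (rule finite_measure_lebesgue_on)
  have dom: "integrable (lebesgue_on \<Omega>) (\<lambda>x. 1 + (f x)\<^sup>2)"
    using assms(2) by (auto simp: L2_def)
  have "\<bar>f x\<bar> \<le> 1 + (f x)\<^sup>2" for x
    using zero_le_power2[of "\<bar>f x\<bar> - 1"] by (simp add: power2_eq_square algebra_simps)
  then show ?thesis
    using assms(2) by (intro Bochner_Integration.integrable_bound[OF dom]) (auto simp: L2_def)
qed

lemma weak_deriv_in_L2:
  assumes "f \<in> sobolev_H k \<Omega>" "fst \<kappa> + snd \<kappa> \<le> k"
  shows "weak_deriv \<Omega> \<kappa> f \<in> L2 \<Omega>"
proof -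
  have "\<exists>g. g \<in> L2 \<Omega> \<and> has_weak_deriv \<Omega> \<kappa> f g"
    using assms unfolding sobolev_H_def by blast
  then show ?thesis
    unfolding weak_deriv_def by (rule someI2_ex) simp
qed

lemma avg_cong:
  assumes "\<And>x. x \<in> \<Omega> \<Longrightarrow> g x = h x"
  shows "avg \<Omega> g = avg \<Omega> h"
proof -
  have "(\<integral>x. g x \<partial>lebesgue_on \<Omega>) = (\<integral>x. h x \<partial>lebesgue_on \<Omega>)"
    by (rule Bochner_Integration.integral_cong) (auto simp: assms)
  then show ?thesis
    by (simp add: avg_def)
qed

lemma avg_add:
  assumes "integrable (lebesgue_on \<Omega>) g" "integrable (lebesgue_on \<Omega>) h"
  shows "avg \<Omega> (\<lambda>x. g x + h x) = avg \<Omega> g + avg \<Omega> h"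
  using assms by (simp add: avg_def scaleR_add_right)

lemma avg_diff:
  assumes "integrable (lebesgue_on \<Omega>) g" "integrable (lebesgue_on \<Omega>) h"
  shows "avg \<Omega> (\<lambda>x. g x - h x) = avg \<Omega> g - avg \<Omega> h"
  using assms by (simp add: avg_def scaleR_diff_right)

lemma avg_cmult:
  shows "avg \<Omega> (\<lambda>x. c * g x) = c * avg \<Omega> (g :: real^2 \<Rightarrow> real)"
  by (simp add: avg_def)

lemma avg_bounded_linear:
  assumes "bounded_linear T" "integrable (lebesgue_on \<Omega>) g"
  shows "T (avg \<Omega> g) = avg \<Omega> (\<lambda>x. T (g x))"
  using assms by (simp add: avg_def integral_bounded_linear linear_simps(5))

section \<open>Two-phase media: one coordinate\<close>

text \<open>The elimination of the phase averages. Here \<open>p1, p2\<close> stand for the averages of the field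
  times the two indicator functions, so that \<open>p1 / f1\<close> and \<open>p2 / f2\<close> are its means over
  the phases, and the first two terms are the translated energy of the piecewise constant field
  with these means. Both factors on the right contain the factor \<open>l1 - l2\<close>:
  \<open>b - lbar a\<close> is proportional to the jump of the means, and the other factor
  to the jump of the translated fluxes; what remains is the identity expressing a covariance of
  two-valued functions through the product of their jumps.\<close>

lemma translation_identity:
  fixes f1 f2 l1 l2 p1 p2 \<sigma> :: real
  assumes f: "f1 + f2 = 1" "0 < f1" "0 < f2" and l: "l1 \<noteq> l2"
    and a: "a = p1 + p2" and b: "b = l1 * p1 + l2 * p2"
    and lbar: "lbar = f1 * l1 + f2 * l2" and d: "d = 1 / (f1 * f2 * (l1 - l2)\<^sup>2)"
  shows "(l1 - \<sigma>) * (p1\<^sup>2 / f1) + (l2 - \<sigma>) * (p2\<^sup>2 / f2) - b * a + \<sigma> * a\<^sup>2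
    = \<sigma> * (d * (b - lbar * a) * (lbar * a - b))
      + d * (b - lbar * a) * ((f2 * l1 + f1 * l2) * b - l1 * l2 * a)"
proof -
  have f2: "f2 = 1 - f1" using f by simp
  \<comment> \<open>Jump of the phase means, times the fractions.\<close>
  have jump: "b - lbar * a = (l1 - l2) * (f2 * p1 - f1 * p2)"
    unfolding a b lbar f2 by algebra
  \<comment> \<open>Jump of the translated fluxes, times the fractions.\<close>
  have flux: "\<sigma> * (lbar * a - b) + ((f2 * l1 + f1 * l2) * b - l1 * l2 * a)
      = (l1 - l2) * (f2 * p1 * (l1 - \<sigma>) - f1 * p2 * (l2 - \<sigma>))"
    unfolding a b lbar f2 by algebra
  have "\<sigma> * (d * (b - lbar * a) * (lbar * a - b))
      + d * (b - lbar * a) * ((f2 * l1 + f1 * l2) * b - l1 * l2 * a)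
      = d * (b - lbar * a) * (\<sigma> * (lbar * a - b) + ((f2 * l1 + f1 * l2) * b - l1 * l2 * a))"
    by algebra
  also have "\<dots> = (d * (l1 - l2)\<^sup>2) * ((f2 * p1 - f1 * p2) * (f2 * p1 * (l1 - \<sigma>) - f1 * p2 * (l2 - \<sigma>)))"
    unfolding jump flux by algebra
  also have "d * (l1 - l2)\<^sup>2 = 1 / (f1 * f2)"
    using l by (simp add: d)
  also have "1 / (f1 * f2) * ((f2 * p1 - f1 * p2) * (f2 * p1 * (l1 - \<sigma>) - f1 * p2 * (l2 - \<sigma>)))
      = (l1 - \<sigma>) * (p1\<^sup>2 * (f2 / f1)) + (l2 - \<sigma>) * (p2\<^sup>2 * (f1 / f2)) - p1 * p2 * ((l1 - \<sigma>) + (l2 - \<sigma>))"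
    using f(2,3) by (simp add: field_simps power2_eq_square)
  also have "f2 / f1 = 1 / f1 - 1"
    using f by (simp add: field_simps)
  also have "f1 / f2 = 1 / f2 - 1"
    using f by (simp add: field_simps)
  finally show ?thesis
    unfolding a b by (simp add: algebra_simps power2_eq_square)
qed

locale two_phase =
  fixes \<Omega> :: "(real^2) set" and P :: "2 \<Rightarrow> (real^2) set" and f :: "2 \<Rightarrow> real"
  assumes bounded: "bounded \<Omega>"
    and measurable: "P j \<in> sets lebesgue"
    and cover: "P 1 \<union> P 2 = \<Omega>" and disjoint: "P 1 \<inter> P 2 = {}"
    and fraction: "f j = avg \<Omega> (indicat_real (P j))" and fraction_pos: "0 < f j"
begin

lemma domain_lmeasurable: "\<Omega> \<in> lmeasurable"
  using bounded measurable cover by (intro bounded_set_imp_lmeasurable) auto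

lemma phase_subset: "P j \<subseteq> \<Omega>"
  using cover exhaust_2[of j] by auto

lemma phase_cases:
  assumes "x \<in> \<Omega>"
  obtains "indicat_real (P 1) x = 1" "indicat_real (P 2) x = 0" "x \<in> P 1"
    | "indicat_real (P 1) x = 0" "indicat_real (P 2) x = 1" "x \<in> P 2"
proof -
  have "x \<in> P 1 \<and> x \<notin> P 2 \<or> x \<notin> P 1 \<and> x \<in> P 2"
    using assms cover disjoint by auto
  then show thesis
    using that by auto
qed

lemma integrable_on_phase:
  assumes "integrable (lebesgue_on \<Omega>) g"
  shows "integrable (lebesgue_on \<Omega>) (\<lambda>x. indicat_real (P j) x * g x)"
proof -
  have "P j \<in> sets (lebesgue_on \<Omega>)"
    using measurable phase_subset domain_lmeasurable by (auto simp: sets_restrict_space_iff)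
  from integrable_mult_indicator[OF this assms] show ?thesis
    by simp
qed

text \<open>On a null set every average would be zero, contradicting the positive volume fractions.\<close>

lemma domain_measure_pos: "0 < measure lebesgue \<Omega>"
proof (rule ccontr)
  assume "\<not> 0 < measure lebesgue \<Omega>"
  then have "measure lebesgue \<Omega> = 0"
    using measure_nonneg[of lebesgue \<Omega>] by linarith
  then show False
    using fraction_pos[of 1] by (simp add: fraction avg_def)
qed

lemma integrable_one: "integrable (lebesgue_on \<Omega>) (\<lambda>x. 1::real)"
proof -
  interpret finite_measure "lebesgue_on \<Omega>"
    using domain_lmeasurable by (rule finite_measure_lebesgue_on)
  show ?thesis by simp
qed

lemma integrable_indicator: "integrable (lebesgue_on \<Omega>) (indicat_real (P j))"
  using integrable_on_phase[OF integrable_one] by simp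

lemma avg_nonneg:
  assumes "integrable (lebesgue_on \<Omega>) g" "\<And>x. 0 \<le> (g x :: real)"
  shows "0 \<le> avg \<Omega> g"
  using assms by (simp add: avg_def)

lemma avg_split:
  assumes g: "integrable (lebesgue_on \<Omega>) g"
  shows "avg \<Omega> (\<lambda>x. piecewise_const P l x * g x)
      = l 1 * avg \<Omega> (\<lambda>x. indicat_real (P 1) x * g x) + l 2 * avg \<Omega> (\<lambda>x. indicat_real (P 2) x * g x)"
proof -
  have "avg \<Omega> (\<lambda>x. piecewise_const P l x * g x)
      = avg \<Omega> (\<lambda>x. l 1 * (indicat_real (P 1) x * g x) + l 2 * (indicat_real (P 2) x * g x))"
    by (simp add: piecewise_const_def algebra_simps)
  also have "\<dots> = avg \<Omega> (\<lambda>x. l 1 * (indicat_real (P 1) x * g x)) + avg \<Omega> (\<lambda>x. l 2 * (indicat_real (P 2) x * g x))"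
    by (intro avg_add integrable_mult_right integrable_on_phase g)
  finally show ?thesis
    by (simp add: avg_cmult)
qed

lemma avg_eq_phase_sum:
  assumes "integrable (lebesgue_on \<Omega>) g"
  shows "avg \<Omega> g
      = avg \<Omega> (\<lambda>x. indicat_real (P 1) x * g x) + avg \<Omega> (\<lambda>x. indicat_real (P 2) x * g x)"
proof -
  have "avg \<Omega> g = avg \<Omega> (\<lambda>x. piecewise_const P (\<lambda>_. 1) x * g x)"
    by (rule avg_cong) (auto simp: piecewise_const_def elim: phase_cases)
  then show ?thesis
    using avg_split[OF assms, of "\<lambda>_. 1"] by simp
qed

lemma fractions_sum: "f 1 + f 2 = 1"
proof -
  have "avg \<Omega> (\<lambda>x. 1::real) = 1"
    using domain_measure_pos domain_lmeasurable
    by (simp add: avg_def measure_restrict_space)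
  then show ?thesis
    using avg_eq_phase_sum[OF integrable_one] by (simp add: fraction)
qed

text \<open>The variance of the field over one phase is nonnegative.\<close>

lemma phase_cauchy_schwarz:
  assumes v: "v \<in> L2 \<Omega>"
  shows "(avg \<Omega> (\<lambda>x. indicat_real (P j) x * v x))\<^sup>2 / f j
      \<le> avg \<Omega> (\<lambda>x. indicat_real (P j) x * (v x)\<^sup>2)"
proof -
  define p q c where "p = avg \<Omega> (\<lambda>x. indicat_real (P j) x * v x)"
    and "q = avg \<Omega> (\<lambda>x. indicat_real (P j) x * (v x)\<^sup>2)" and "c = p / f j"
  have iv: "integrable (lebesgue_on \<Omega>) v" "integrable (lebesgue_on \<Omega>) (\<lambda>x. (v x)\<^sup>2)"
    using L2_integrable[OF domain_lmeasurable v] v by (auto simp: L2_def)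
  note i = integrable_on_phase[OF iv(1), of j] integrable_on_phase[OF iv(2), of j] integrable_indicator[of j]
  have eq: "indicat_real (P j) x * (v x - c)\<^sup>2
      = (indicat_real (P j) x * (v x)\<^sup>2 - (2 * c) * (indicat_real (P j) x * v x)) + c\<^sup>2 * indicat_real (P j) x" for x
    by (simp add: power2_eq_square algebra_simps)
  have "0 \<le> avg \<Omega> (\<lambda>x. indicat_real (P j) x * (v x - c)\<^sup>2)"
  proof (rule avg_nonneg)
    show "integrable (lebesgue_on \<Omega>) (\<lambda>x. indicat_real (P j) x * (v x - c)\<^sup>2)"
      unfolding eq using i by simp
  qed simp
  also have "\<dots> = (q - (2 * c) * p) + c\<^sup>2 * f j"
    unfolding eq p_def q_def fraction using i by (simp add: avg_add avg_diff avg_cmult)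
  also have "\<dots> = q - p\<^sup>2 / f j"
    using fraction_pos[of j] by (simp add: c_def field_simps power2_eq_square)
  finally show ?thesis
    by (simp add: p_def q_def)
qed

text \<open>After the translation by \<open>\<sigma>\<close> the coefficients \<open>l j - \<sigma>\<close> are nonnegative, so
  the energy is bounded below phase by phase, with equality for piecewise constant fields; the
  resulting value is rewritten in terms of \<open>a\<close> and \<open>b\<close> by the identity above.\<close>

lemma translation_bound_coordinate:
  assumes v: "v \<in> L2 \<Omega>" and l: "l 1 \<noteq> l 2" and \<sigma>: "\<And>j. \<sigma> \<le> l j"
    and a: "a = avg \<Omega> v" and b: "b = avg \<Omega> (\<lambda>x. piecewise_const P l x * v x)"
    and lbar: "lbar = f 1 * l 1 + f 2 * l 2" and d: "d = 1 / (f 1 * f 2 * (l 1 - l 2)\<^sup>2)"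
  shows "avg \<Omega> (\<lambda>x. piecewise_const P l x * (v x)\<^sup>2) - b * a
      \<ge> \<sigma> * (d * (b - lbar * a) * (lbar * a - b) + avg \<Omega> (\<lambda>x. (v x)\<^sup>2) - a\<^sup>2)
        + d * (b - lbar * a) * ((f 2 * l 1 + f 1 * l 2) * b - l 1 * l 2 * a)"
proof -
  define p q where "p j = avg \<Omega> (\<lambda>x. indicat_real (P j) x * v x)"
    and "q j = avg \<Omega> (\<lambda>x. indicat_real (P j) x * (v x)\<^sup>2)" for j
  have iv: "integrable (lebesgue_on \<Omega>) v" "integrable (lebesgue_on \<Omega>) (\<lambda>x. (v x)\<^sup>2)"
    using L2_integrable[OF domain_lmeasurable v] v by (auto simp: L2_def)
  have pq: "a = p 1 + p 2" "b = l 1 * p 1 + l 2 * p 2" "avg \<Omega> (\<lambda>x. (v x)\<^sup>2) = q 1 + q 2"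
    "avg \<Omega> (\<lambda>x. piecewise_const P l x * (v x)\<^sup>2) = l 1 * q 1 + l 2 * q 2"
    unfolding a b p_def q_def
    using avg_eq_phase_sum[OF iv(1)] avg_eq_phase_sum[OF iv(2)] avg_split[OF iv(1)] avg_split[OF iv(2)]
    by auto
  have "(l j - \<sigma>) * ((p j)\<^sup>2 / f j) \<le> (l j - \<sigma>) * q j" for j
    using phase_cauchy_schwarz[OF v] \<sigma> unfolding p_def q_def by (intro mult_left_mono) auto
  from this[of 1] this[of 2] show ?thesis
    using translation_identity[OF fractions_sum fraction_pos fraction_pos l pq(1,2) lbar d, of \<sigma>]
    unfolding pq(3,4) by (simp add: algebra_simps)
qed

end

section \<open>Two-phase media: fields with values in three-space\<close>

lemma diag3_simps:
  "diag3 a b c + diag3 a' b' c' = diag3 (a + a') (b + b') (c + c')"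
  "diag3 a b c - diag3 a' b' c' = diag3 (a - a') (b - b') (c - c')"
  "t *\<^sub>R diag3 a b c = diag3 (t * a) (t * b) (t * c)"
  "diag3 a b c ** diag3 a' b' c' = diag3 (a * a') (b * b') (c * c')"
  by (simp_all add: diag3_def vec_eq_iff forall_3 matrix_matrix_mult_def sum_3)

lemma diag3_mult_vec:
  "(diag3 a b c *v v) $ 1 = a * v $ 1"
  "(diag3 a b c *v v) $ 2 = b * v $ 2"
  "(diag3 a b c *v v) $ 3 = c * v $ 3"
  by (simp_all add: diag3_def matrix_vector_mult_def sum_3)

lemma diag3_one: "diag3 1 1 1 = mat 1"
  by (simp add: diag3_def mat_def vec_eq_iff forall_3)

lemma matrix_inv_diag3:
  assumes "a \<noteq> 0" "b \<noteq> 0" "c \<noteq> 0"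
  shows "matrix_inv (diag3 a b c) = diag3 (1 / a) (1 / b) (1 / c)"
proof -
  have inv: "diag3 a b c ** diag3 (1 / a) (1 / b) (1 / c) = mat 1"
    "diag3 (1 / a) (1 / b) (1 / c) ** diag3 a b c = mat 1"
    using assms by (simp_all add: diag3_simps diag3_one)
  then have "invertible (diag3 a b c)"
    by (auto simp: invertible_def)
  then have "diag3 a b c ** matrix_inv (diag3 a b c) = mat 1"
    unfolding matrix_inv_def invertible_def by (rule someI2_ex) simp
  then show ?thesis
    by (metis inv(2) matrix_mul_assoc matrix_mul_lid matrix_mul_rid)
qed

context two_phase
begin

text \<open>All matrices are diagonal, so the inequality is the sum of its three coordinates. The
  matrix \<open>T\<close> has entries \<open>1, -1, -1\<close>: the translation parameter is \<open>\<zeta>\<close> in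
  the first coordinate and \<open>-\<zeta>\<close> in the others, which explains the two-sided range of
  \<open>\<zeta>\<close>.\<close>

lemma translation_bound_vector:
  fixes v w :: "real^2 \<Rightarrow> real^3" and L S :: "2 \<Rightarrow> real^3^3"
  assumes v: "\<And>k. (\<lambda>x. v x $ k) \<in> L2 \<Omega>"
    and w: "\<And>j x. x \<in> P j \<Longrightarrow> w x = L j *v v x"
    and a: "\<And>k. a $ k = avg \<Omega> (\<lambda>x. v x $ k)" and b: "\<And>k. b $ k = avg \<Omega> (\<lambda>x. w x $ k)"
    and L: "\<And>j. L j = diag3 (\<alpha> j) (\<beta> j) (\<beta> j)" and Lav: "Lav = f 1 *\<^sub>R L 1 + f 2 *\<^sub>R L 2"
    and S: "\<And>j. S j = L j - \<zeta> *\<^sub>R mat_T"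
    and D: "D = (1 / (f 1 * f 2)) *\<^sub>R mat_inv_sq (S 1 - S 2)"
    and distinct: "\<alpha> 1 \<noteq> \<alpha> 2" "\<beta> 1 \<noteq> \<beta> 2"
    and zeta: "\<zeta> \<in> {- min (\<beta> 1) (\<beta> 2)<..<min (\<alpha> 1) (\<alpha> 2)}"
  shows "avg \<Omega> (\<lambda>x. w x \<bullet> v x) - b \<bullet> a
    \<ge> \<zeta> * ((D *v (b - Lav *v a)) \<bullet> (Lav *v (mat_T *v a) - mat_T *v b)
          + avg \<Omega> (\<lambda>x. v x \<bullet> (mat_T *v v x)) - a \<bullet> (mat_T *v a))
      + (D *v (b - Lav *v a)) \<bullet> ((f 2 *\<^sub>R L 1 + f 1 *\<^sub>R L 2) *v b - (L 1 ** L 2) *v a)"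
proof -
  \<comment> \<open>Diagonal entries of the phase matrices, of \<open>T\<close>, of \<open>Lav\<close> and of \<open>D\<close>.\<close>
  define l :: "3 \<Rightarrow> 2 \<Rightarrow> real" where "l k = (if k = 1 then \<alpha> else \<beta>)" for k
  define t :: "3 \<Rightarrow> real" where "t k = (if k = 1 then 1 else - 1)" for k
  define lbar where "lbar k = f 1 * l k 1 + f 2 * l k 2" for k
  define d where "d k = 1 / (f 1 * f 2 * (l k 1 - l k 2)\<^sup>2)" for k
  have sq: "integrable (lebesgue_on \<Omega>) (\<lambda>x. (v x $ k)\<^sup>2)" for k
    using v by (simp add: L2_def)
  have wk: "w x $ k = piecewise_const P (l k) x * v x $ k" if "x \<in> \<Omega>" for x k
    using that exhaust_3[of k]
    by (auto simp: piecewise_const_def w L l_def diag3_mult_vec elim!: phase_cases)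
  have isq: "integrable (lebesgue_on \<Omega>) (\<lambda>x. piecewise_const P (l k) x * (v x $ k)\<^sup>2)" for k
    using integrable_on_phase[OF sq] by (auto simp: piecewise_const_def distrib_right mult.assoc)
  have bk: "b $ k = avg \<Omega> (\<lambda>x. piecewise_const P (l k) x * v x $ k)" for k
    unfolding b by (rule avg_cong) (rule wk)
  have energy: "avg \<Omega> (\<lambda>x. w x \<bullet> v x)
      = (\<Sum>k\<in>UNIV. avg \<Omega> (\<lambda>x. piecewise_const P (l k) x * (v x $ k)\<^sup>2))"
  proof -
    have "avg \<Omega> (\<lambda>x. w x \<bullet> v x) = avg \<Omega> (\<lambda>x. piecewise_const P (l 1) x * (v x $ 1)\<^sup>2
        + piecewise_const P (l 2) x * (v x $ 2)\<^sup>2 + piecewise_const P (l 3) x * (v x $ 3)\<^sup>2)"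
      by (rule avg_cong) (simp add: inner_vec_def sum_3 wk power2_eq_square mult.assoc)
    then show ?thesis
      using isq by (simp add: avg_add sum_3)
  qed
  have nullform: "avg \<Omega> (\<lambda>x. v x \<bullet> (mat_T *v v x)) = (\<Sum>k\<in>UNIV. t k * avg \<Omega> (\<lambda>x. (v x $ k)\<^sup>2))"
  proof -
    have "avg \<Omega> (\<lambda>x. v x \<bullet> (mat_T *v v x)) = avg \<Omega> (\<lambda>x. (v x $ 1)\<^sup>2 - (v x $ 2)\<^sup>2 - (v x $ 3)\<^sup>2)"
      by (rule avg_cong)
        (simp add: inner_vec_def sum_3 mat_T_def diag3_mult_vec power2_eq_square)
    then show ?thesis
      using sq by (simp add: avg_diff sum_3 t_def)
  qed
  have "avg \<Omega> (\<lambda>x. piecewise_const P (l k) x * (v x $ k)\<^sup>2) - b $ k * a $ k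
      \<ge> (t k * \<zeta>) * (d k * (b $ k - lbar k * a $ k) * (lbar k * a $ k - b $ k)
            + avg \<Omega> (\<lambda>x. (v x $ k)\<^sup>2) - (a $ k)\<^sup>2)
        + d k * (b $ k - lbar k * a $ k) * ((f 2 * l k 1 + f 1 * l k 2) * b $ k - l k 1 * l k 2 * a $ k)" for k
  proof (rule translation_bound_coordinate[OF v _ _ a bk lbar_def d_def])
    show "l k 1 \<noteq> l k 2"
      using distinct by (simp add: l_def)
    show "t k * \<zeta> \<le> l k j" for j
      using zeta exhaust_2[of j] by (auto simp: t_def l_def)
  qed
  note bound = this
  have Dd: "D = diag3 (d 1) (d 2) (d 3)"
    using distinct
    by (simp add: D S L mat_T_def mat_inv_sq_def diag3_simps matrix_inv_diag3 d_def l_def power2_eq_square)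
  have Lavd: "Lav = diag3 (lbar 1) (lbar 2) (lbar 3)"
    by (simp add: Lav L diag3_simps lbar_def l_def)
  have mixd: "f 2 *\<^sub>R L 1 + f 1 *\<^sub>R L 2
      = diag3 (f 2 * l 1 1 + f 1 * l 1 2) (f 2 * l 2 1 + f 1 * l 2 2) (f 2 * l 3 1 + f 1 * l 3 2)"
    "L 1 ** L 2 = diag3 (l 1 1 * l 1 2) (l 2 1 * l 2 2) (l 3 1 * l 3 2)"
    by (simp_all add: L diag3_simps l_def)
  show ?thesis
  proof -
    \<comment> \<open>Keeping these three factors opaque leaves an inequality that is linear in their products.\<close>
    define X Y Z where "X k = d k * (b $ k - lbar k * a $ k)" and "Y k = lbar k * a $ k - b $ k"
      and "Z k = (f 2 * l k 1 + f 1 * l k 2) * b $ k - l k 1 * l k 2 * a $ k" for k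
    have "D *v (b - Lav *v a) = (\<chi> k. X k)" "Lav *v (mat_T *v a) - mat_T *v b = (\<chi> k. t k * Y k)"
      "(f 2 *\<^sub>R L 1 + f 1 *\<^sub>R L 2) *v b - (L 1 ** L 2) *v a = (\<chi> k. Z k)"
      "mat_T *v a = (\<chi> k. t k * a $ k)"
      unfolding Dd Lavd mixd mat_T_def
      by (simp_all add: vec_eq_iff forall_3 diag3_mult_vec X_def Y_def Z_def t_def algebra_simps)
    note vectors = this
    have "(t k * \<zeta>) * (X k * Y k + avg \<Omega> (\<lambda>x. (v x $ k)\<^sup>2) - (a $ k)\<^sup>2) + X k * Z k
        \<le> avg \<Omega> (\<lambda>x. piecewise_const P (l k) x * (v x $ k)\<^sup>2) - b $ k * a $ k" for k
      using bound[of k] by (simp add: X_def Y_def Z_def)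
    from this[of 1] this[of 2] this[of 3] show ?thesis
      unfolding energy nullform vectors(1-3)
      unfolding vectors(4)
      by (simp add: inner_vec_def sum_3 t_def algebra_simps power2_eq_square)
  qed
qed

end

section \<open>Fields of symmetric matrices\<close>

text \<open>Both elasticity tensors have this form, so one argument serves for the two fields. On the
  trace part it acts as multiplication by \<open>p + 2 q\<close>, on the trace-free part by \<open>p\<close>.\<close>

definition isotropic :: "real \<Rightarrow> real \<Rightarrow> real^2^2 \<Rightarrow> real^2^2" where
  "isotropic p q A = p *\<^sub>R A + (q * trace A) *\<^sub>R mat 1"

lemma tensor_L_isotropic:
  "tensor_L lam mu = isotropic (1 / (4 * mu)) (- lam / (4 * mu * (3 * lam + 2 * mu)))"
  by (simp add: tensor_L_def isotropic_def fun_eq_iff)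

lemma tensor_M_isotropic:
  "tensor_M lam mu = isotropic (4 * mu / 3) (4 * lam * mu / (3 * (lam + 2 * mu)))"
  by (simp add: tensor_M_def isotropic_def fun_eq_iff)

lemma trace_2: "trace (A :: real^2^2) = A $ 1 $ 1 + A $ 2 $ 2"
  by (simp add: trace_def sum_2)

lemma sym_vec_nth:
  "sym_vec A $ 1 = (A $ 1 $ 1 + A $ 2 $ 2) / sqrt 2"
  "sym_vec A $ 2 = (A $ 1 $ 1 - A $ 2 $ 2) / sqrt 2"
  "sym_vec A $ 3 = 2 * A $ 1 $ 2 / sqrt 2"
  by (simp_all add: sym_vec_def)

lemma sym_vec_isotropic: "sym_vec (isotropic p q A) = diag3 (p + 2 * q) p p *v sym_vec A"
  by (simp add: vec_eq_iff forall_3 sym_vec_nth diag3_mult_vec isotropic_def trace_2 mat_def field_simps)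

lemma mat_dot_sym_vec:
  assumes "A $ 1 $ 2 = A $ 2 $ 1" "B $ 1 $ 2 = B $ 2 $ 1"
  shows "mat_dot A B = sym_vec A \<bullet> sym_vec B"
  using assms
  by (simp add: mat_dot_def trace_2 transpose_def matrix_matrix_mult_def sum_2 sum_3 inner_vec_def
      sym_vec_nth field_simps)

lemma det_sym_vec:
  assumes "A $ 1 $ 2 = A $ 2 $ 1"
  shows "2 * det A = sym_vec A \<bullet> (mat_T *v sym_vec A)"
  using assms
  by (simp add: det_2 sum_3 inner_vec_def mat_T_def diag3_mult_vec sym_vec_nth field_simps)

lemma bounded_linear_sym_vec_nth: "bounded_linear (\<lambda>A. sym_vec A $ k)"
proof -
  have "linear (\<lambda>A. sym_vec A $ k)"
    using exhaust_3[of k] by (intro linearI) (auto simp: sym_vec_nth algebra_simps add_divide_distrib diff_divide_distrib)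
  then show ?thesis
    by (simp add: linear_conv_bounded_linear)
qed

text \<open>Bochner integrability is tested on components: a vector is the finite sum of its
  components placed on the axes. Applied twice it covers matrix fields.\<close>

lemma integrable_vec:
  fixes g :: "'a \<Rightarrow> ('b::euclidean_space)^'n"
  assumes "\<And>i. integrable N (\<lambda>x. g x $ i)"
  shows "integrable N g"
proof -
  have bl: "bounded_linear (axis i :: 'b \<Rightarrow> 'b^'n)" for i
    unfolding linear_conv_bounded_linear[symmetric]
    by (intro linearI) (auto simp: axis_def vec_eq_iff)
  have "integrable N (\<lambda>x. \<Sum>i\<in>UNIV. axis i (g x $ i))"
    using integrable_bounded_linear[OF bl assms] by (intro Bochner_Integration.integrable_sum)
  also have "(\<lambda>x. \<Sum>i\<in>UNIV. axis i (g x $ i)) = g"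
    by (simp add: fun_eq_iff vec_eq_iff axis_def if_distrib cong: if_cong)
  finally show ?thesis .
qed

context two_phase
begin

text \<open>The scalar products and determinants of symmetric matrices are turned into quadratic
  forms on three-space, where \<open>translation_bound_vector\<close> applies. Passing from matrices to
  vectors commutes with averages because it is linear and the fields are integrable. The
  tensor is prescribed only inside the phases, as the elastic moduli vanish outside the domain.\<close>

lemma translation_bound_symmetric:
  fixes H C :: "real^2 \<Rightarrow> real^2^2" and L S :: "2 \<Rightarrow> real^3^3"
  assumes H: "\<And>i j. (\<lambda>x. H x $ i $ j) \<in> L2 \<Omega>" and sym: "\<And>x. H x $ 1 $ 2 = H x $ 2 $ 1"
    and C: "\<And>j x. x \<in> P j \<Longrightarrow> C x = isotropic (p j) (q j) (H x)"
    and alpha: "\<And>j. \<alpha> j = p j + 2 * q j" and beta: "\<And>j. \<beta> j = p j"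
    and L: "\<And>j. L j = diag3 (\<alpha> j) (\<beta> j) (\<beta> j)" and Lav: "Lav = f 1 *\<^sub>R L 1 + f 2 *\<^sub>R L 2"
    and S: "\<And>j. S j = L j - \<zeta> *\<^sub>R mat_T"
    and D: "D = (1 / (f 1 * f 2)) *\<^sub>R mat_inv_sq (S 1 - S 2)"
    and distinct: "\<alpha> 1 \<noteq> \<alpha> 2" "\<beta> 1 \<noteq> \<beta> 2"
    and zeta: "\<zeta> \<in> {- min (\<beta> 1) (\<beta> 2)<..<min (\<alpha> 1) (\<alpha> 2)}"
    and a: "a = sym_vec (avg \<Omega> H)" and b: "b = sym_vec (avg \<Omega> C)"
  shows "avg \<Omega> (\<lambda>x. mat_dot (C x) (H x)) - b \<bullet> a
    \<ge> \<zeta> * ((D *v (b - Lav *v a)) \<bullet> (Lav *v (mat_T *v a) - mat_T *v b)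
          + 2 * avg \<Omega> (\<lambda>x. det (H x)) - 2 * det (avg \<Omega> H))
      + (D *v (b - Lav *v a)) \<bullet> ((f 2 *\<^sub>R L 1 + f 1 *\<^sub>R L 2) *v b - (L 1 ** L 2) *v a)"
proof -
  have iH: "integrable (lebesgue_on \<Omega>) (\<lambda>x. H x $ i $ j)" for i j
    by (rule L2_integrable[OF domain_lmeasurable H])
  have iHm: "integrable (lebesgue_on \<Omega>) H"
    by (intro integrable_vec iH)
  have Cx: "C x = indicat_real (P 1) x *\<^sub>R isotropic (p 1) (q 1) (H x)
      + indicat_real (P 2) x *\<^sub>R isotropic (p 2) (q 2) (H x)" if "x \<in> \<Omega>" for x
    using that by (auto elim!: phase_cases simp: C)
  \<comment> \<open>A combination of indicator functions of the phases with integrable fields.\<close>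
  have iC: "integrable (lebesgue_on \<Omega>) C"
  proof -
    have "integrable (lebesgue_on \<Omega>) (\<lambda>x. C x $ i $ j)" for i j
    proof -
      have iso: "integrable (lebesgue_on \<Omega>) (\<lambda>x. isotropic (p k) (q k) (H x) $ i $ j)" for k
        using iH by (auto simp: isotropic_def trace_2)
      have "integrable (lebesgue_on \<Omega>) (\<lambda>x. C x $ i $ j) \<longleftrightarrow>
          integrable (lebesgue_on \<Omega>) (\<lambda>x. indicat_real (P 1) x * isotropic (p 1) (q 1) (H x) $ i $ j
            + indicat_real (P 2) x * isotropic (p 2) (q 2) (H x) $ i $ j)"
        by (rule Bochner_Integration.integrable_cong) (auto simp: Cx)
      then show ?thesis
        using integrable_on_phase[OF iso] by auto
    qed
    then show ?thesis
      by (intro integrable_vec)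
  qed
  have symC: "C x $ 1 $ 2 = C x $ 2 $ 1" if "x \<in> \<Omega>" for x
    using that by (auto simp: Cx isotropic_def sym mat_def)
  have symavg: "avg \<Omega> H $ 1 $ 2 = avg \<Omega> H $ 2 $ 1"
  proof -
    have "bounded_linear (\<lambda>A :: real^2^2. A $ i $ j)" for i j
      by (rule bounded_linear_compose[OF bounded_linear_vec_nth bounded_linear_vec_nth])
    from avg_bounded_linear[OF this iHm] show ?thesis
      by (simp add: sym)
  qed
  have "avg \<Omega> (\<lambda>x. sym_vec (C x) \<bullet> sym_vec (H x)) - b \<bullet> a
    \<ge> \<zeta> * ((D *v (b - Lav *v a)) \<bullet> (Lav *v (mat_T *v a) - mat_T *v b)
          + avg \<Omega> (\<lambda>x. sym_vec (H x) \<bullet> (mat_T *v sym_vec (H x))) - a \<bullet> (mat_T *v a))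
      + (D *v (b - Lav *v a)) \<bullet> ((f 2 *\<^sub>R L 1 + f 1 *\<^sub>R L 2) *v b - (L 1 ** L 2) *v a)"
  proof (rule translation_bound_vector[OF _ _ _ _ L Lav S D distinct zeta])
    show "(\<lambda>x. sym_vec (H x) $ k) \<in> L2 \<Omega>" for k
    proof -
      have "(\<lambda>x. (1 / sqrt 2) * (H x $ 1 $ 1 + H x $ 2 $ 2)) \<in> L2 \<Omega>"
        "(\<lambda>x. (1 / sqrt 2) * (H x $ 1 $ 1 - H x $ 2 $ 2)) \<in> L2 \<Omega>"
        "(\<lambda>x. (2 / sqrt 2) * H x $ 1 $ 2) \<in> L2 \<Omega>"
        by (intro L2_cmult L2_add L2_diff H)+
      then show ?thesis
        using exhaust_3[of k] by (auto simp: sym_vec_nth)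
    qed
    show "sym_vec (C x) = L j *v sym_vec (H x)" if "x \<in> P j" for j x
      using C[OF that] by (simp add: sym_vec_isotropic L alpha beta)
    show "a $ k = avg \<Omega> (\<lambda>x. sym_vec (H x) $ k)" for k
      unfolding a by (rule avg_bounded_linear[OF bounded_linear_sym_vec_nth iHm])
    show "b $ k = avg \<Omega> (\<lambda>x. sym_vec (C x) $ k)" for k
      unfolding b by (rule avg_bounded_linear[OF bounded_linear_sym_vec_nth iC])
  qed
  moreover have "avg \<Omega> (\<lambda>x. sym_vec (C x) \<bullet> sym_vec (H x)) = avg \<Omega> (\<lambda>x. mat_dot (C x) (H x))"
    by (rule avg_cong) (simp add: mat_dot_sym_vec symC sym)
  moreover have "avg \<Omega> (\<lambda>x. sym_vec (H x) \<bullet> (mat_T *v sym_vec (H x))) = 2 * avg \<Omega> (\<lambda>x. det (H x))"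
    by (simp add: det_sym_vec[OF sym, symmetric] avg_cmult)
  moreover have "a \<bullet> (mat_T *v a) = 2 * det (avg \<Omega> H)"
    unfolding a by (rule det_sym_vec[OF symavg, symmetric])
  ultimately show ?thesis
    by simp
qed

end

section \<open>The bound for the shell\<close>

lemma whess_in_L2:
  assumes "g \<in> sobolev_H 2 \<Omega>"
  shows "(\<lambda>x. whess \<Omega> g x $ i $ j) \<in> L2 \<Omega>"
proof -
  have "weak_deriv \<Omega> (2, 0) g \<in> L2 \<Omega>" "weak_deriv \<Omega> (1, 1) g \<in> L2 \<Omega>" "weak_deriv \<Omega> (0, 2) g \<in> L2 \<Omega>"
    by (rule weak_deriv_in_L2[OF assms], simp)+
  then show ?thesis
    using exhaust_2[of i] exhaust_2[of j] by (auto simp: whess_def)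
qed

lemma whess_sym: "whess \<Omega> g x $ 1 $ 2 = whess \<Omega> g x $ 2 $ 1"
  by (simp add: whess_def)

theorem theorem3p1:
  fixes \<Omega> :: "(real^2) set" and P :: "2 \<Rightarrow> (real^2) set"
    and \<theta> u3 \<psi> lamf muf :: "real^2 \<Rightarrow> real" and u' :: "real^2 \<Rightarrow> real^2"
    and s m :: "real^2 \<Rightarrow> real^2^2"
    and f lam mu \<alpha> \<beta> \<alpha>t \<beta>t :: "2 \<Rightarrow> real"
    and e0 c0 ct0 \<zeta> \<zeta>t :: real
    and a0 b0 at0 bt0 :: "real^2^2" and va vb vat vbt :: "real^3"
    and L M S St :: "2 \<Rightarrow> real^3^3" and Lav Mav D Dt :: "real^3^3"
  assumes domain: "open \<Omega>" "connected \<Omega>" "\<Omega> \<noteq> {}" "bounded \<Omega>" "simply_connected \<Omega>"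
      "smooth_boundary \<Omega>"
    and theta: "C2_closure \<Omega> \<theta>"
    and phases: "\<And>j. P j \<in> sets lebesgue" "P 1 \<union> P 2 = \<Omega>" "P 1 \<inter> P 2 = {}"
    and fractions: "\<And>j. f j = avg \<Omega> (indicat_real (P j))" "\<And>j. 0 < f j \<and> f j < 1"
    and moduli: "\<And>j. mu j > 0" "\<And>j. 2 * mu j + 3 * lam j > 0"
      "lamf = piecewise_const P lam" "muf = piecewise_const P mu"
    and alpha: "\<And>j. \<alpha> j = (lam j + 2 * mu j) / (4 * mu j * (2 * mu j + 3 * lam j))"
    and beta: "\<And>j. \<beta> j = 1 / (4 * mu j)"
    and alphat: "\<And>j. \<alpha>t j = 4 * mu j * (3 * lam j + 2 * mu j) / (3 * (lam j + 2 * mu j))"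
    and betat: "\<And>j. \<beta>t j = 4 * mu j / 3"
    and distinct: "\<alpha> 1 \<noteq> \<alpha> 2" "\<beta> 1 \<noteq> \<beta> 2"
    and displacement: "\<And>i. (\<lambda>x. u' x $ i) \<in> sobolev_H 1 \<Omega>" "u3 \<in> sobolev_H 2 \<Omega>"
    and moment: "\<And>x. m x = (4 * muf x / 3) *\<^sub>R whess \<Omega> u3 x
        + (4 * lamf x * muf x / (3 * (lamf x + 2 * muf x)) * trace (whess \<Omega> u3 x)) *\<^sub>R mat 1"
    and stress: "\<And>x. s x = stress_of_strain (lamf x) (muf x) (shell_strain \<Omega> \<theta> u' u3 x)"
    and solution: "weak_shell_equations \<Omega> \<theta> s m"
    and psi: "\<psi> \<in> sobolev_H 2 \<Omega>"
      "AE x in lebesgue_on \<Omega>. s x =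
         vector [vector [  weak_deriv \<Omega> (0,2) \<psi> x, - weak_deriv \<Omega> (1,1) \<psi> x],
                 vector [- weak_deriv \<Omega> (1,1) \<psi> x,   weak_deriv \<Omega> (2,0) \<psi> x]]"
    and e0: "e0 = avg \<Omega> (\<lambda>x. mat_dot (tensor_L (lamf x) (muf x) (whess \<Omega> \<psi> x)) (whess \<Omega> \<psi> x))
                + avg \<Omega> (\<lambda>x. mat_dot (tensor_M (lamf x) (muf x) (whess \<Omega> u3 x)) (whess \<Omega> u3 x))"
    and a0: "a0 = avg \<Omega> (\<lambda>x. whess \<Omega> \<psi> x)"
    and b0: "b0 = avg \<Omega> (\<lambda>x. tensor_L (lamf x) (muf x) (whess \<Omega> \<psi> x))"
    and c0: "c0 = avg \<Omega> (\<lambda>x. det (whess \<Omega> \<psi> x))"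
    and at0: "at0 = avg \<Omega> (\<lambda>x. whess \<Omega> u3 x)"
    and bt0: "bt0 = avg \<Omega> (\<lambda>x. tensor_M (lamf x) (muf x) (whess \<Omega> u3 x))"
    and ct0: "ct0 = avg \<Omega> (\<lambda>x. det (whess \<Omega> u3 x))"
    and vectors: "va = sym_vec a0" "vb = sym_vec b0" "vat = sym_vec at0" "vbt = sym_vec bt0"
    and L: "\<And>j. L j = diag3 (\<alpha> j) (\<beta> j) (\<beta> j)" and M: "\<And>j. M j = diag3 (\<alpha>t j) (\<beta>t j) (\<beta>t j)"
    and Lav: "Lav = f 1 *\<^sub>R L 1 + f 2 *\<^sub>R L 2" and Mav: "Mav = f 1 *\<^sub>R M 1 + f 2 *\<^sub>R M 2"
    and S: "\<And>j. S j = L j - \<zeta> *\<^sub>R mat_T" and St: "\<And>j. St j = M j - \<zeta>t *\<^sub>R mat_T"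
    and D: "D = (1 / (f 1 * f 2)) *\<^sub>R mat_inv_sq (S 1 - S 2)"
    and Dt: "Dt = (1 / (f 1 * f 2)) *\<^sub>R mat_inv_sq (St 1 - St 2)"
    and zeta: "\<zeta> \<in> {- min (\<beta> 1) (\<beta> 2)<..<min (\<alpha> 1) (\<alpha> 2)}"
    and zetat: "\<zeta>t \<in> {- min (\<beta>t 1) (\<beta>t 2)<..<min (\<alpha>t 1) (\<alpha>t 2)}"
  shows "e0 - vb \<bullet> va - vbt \<bullet> vat \<ge>
      \<zeta> * ((D *v (vb - Lav *v va)) \<bullet> (Lav *v (mat_T *v va) - mat_T *v vb) + 2 * c0 - 2 * det a0)
    + (D *v (vb - Lav *v va)) \<bullet> ((f 2 *\<^sub>R L 1 + f 1 *\<^sub>R L 2) *v vb - (L 1 ** L 2) *v va)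
    + \<zeta>t * ((Dt *v (vbt - Mav *v vat)) \<bullet> (Mav *v (mat_T *v vat) - mat_T *v vbt) + 2 * ct0 - 2 * det at0)
    + (Dt *v (vbt - Mav *v vat)) \<bullet> ((f 2 *\<^sub>R M 1 + f 1 *\<^sub>R M 2) *v vbt - (M 1 ** M 2) *v vat)"
proof -
  interpret two_phase \<Omega> P f
    using domain(4) phases fractions by unfold_locales auto
  have lam2: "lam j + 2 * mu j > 0" for j
    using moduli(1,2)[of j] by linarith
  have pc: "piecewise_const P c x = c j" if "x \<in> P j" for c x j
    using that exhaust_2[of j] phases(3) by (auto simp: piecewise_const_def indicator_def)
  have reciprocal: "\<alpha>t j = 1 / (3 * \<alpha> j)" "\<beta>t j = 1 / (3 * \<beta> j)" for j
    by (simp_all add: alpha alphat beta betat add.commute)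
  have pos: "\<alpha> j > 0" "\<beta> j > 0" for j
    using moduli(1,2)[of j] lam2[of j] by (simp_all add: alpha beta)
  have distinct_t: "\<alpha>t 1 \<noteq> \<alpha>t 2" "\<beta>t 1 \<noteq> \<beta>t 2"
    using distinct pos[of 1] pos[of 2] by (auto simp: reciprocal)
  have "avg \<Omega> (\<lambda>x. mat_dot (tensor_L (lamf x) (muf x) (whess \<Omega> \<psi> x)) (whess \<Omega> \<psi> x)) - vb \<bullet> va \<ge>
      \<zeta> * ((D *v (vb - Lav *v va)) \<bullet> (Lav *v (mat_T *v va) - mat_T *v vb)
           + 2 * avg \<Omega> (\<lambda>x. det (whess \<Omega> \<psi> x)) - 2 * det (avg \<Omega> (whess \<Omega> \<psi>)))
    + (D *v (vb - Lav *v va)) \<bullet> ((f 2 *\<^sub>R L 1 + f 1 *\<^sub>R L 2) *v vb - (L 1 ** L 2) *v va)"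
  proof (rule translation_bound_symmetric[OF whess_in_L2[OF psi(1)] whess_sym _ _ _ L Lav S D distinct zeta])
    show "tensor_L (lamf x) (muf x) (whess \<Omega> \<psi> x)
        = isotropic (1 / (4 * mu j)) (- lam j / (4 * mu j * (3 * lam j + 2 * mu j))) (whess \<Omega> \<psi> x)"
      if "x \<in> P j" for j x
      by (simp add: tensor_L_isotropic moduli(3,4) pc[OF that])
    show "\<alpha> j = 1 / (4 * mu j) + 2 * (- lam j / (4 * mu j * (3 * lam j + 2 * mu j)))" for j
      unfolding alpha using moduli(1,2)[of j]
      by (simp add: divide_simps) (simp add: algebra_simps)
  qed (simp_all add: beta vectors a0 b0)
  moreover have "avg \<Omega> (\<lambda>x. mat_dot (tensor_M (lamf x) (muf x) (whess \<Omega> u3 x)) (whess \<Omega> u3 x)) - vbt \<bullet> vat \<ge>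
      \<zeta>t * ((Dt *v (vbt - Mav *v vat)) \<bullet> (Mav *v (mat_T *v vat) - mat_T *v vbt)
           + 2 * avg \<Omega> (\<lambda>x. det (whess \<Omega> u3 x)) - 2 * det (avg \<Omega> (whess \<Omega> u3)))
    + (Dt *v (vbt - Mav *v vat)) \<bullet> ((f 2 *\<^sub>R M 1 + f 1 *\<^sub>R M 2) *v vbt - (M 1 ** M 2) *v vat)"
  proof (rule translation_bound_symmetric[OF whess_in_L2[OF displacement(2)] whess_sym _ _ _ M Mav St Dt distinct_t zetat])
    show "tensor_M (lamf x) (muf x) (whess \<Omega> u3 x)
        = isotropic (4 * mu j / 3) (4 * lam j * mu j / (3 * (lam j + 2 * mu j))) (whess \<Omega> u3 x)"
      if "x \<in> P j" for j x
      by (simp add: tensor_M_isotropic moduli(3,4) pc[OF that])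
    show "\<alpha>t j = 4 * mu j / 3 + 2 * (4 * lam j * mu j / (3 * (lam j + 2 * mu j)))" for j
      unfolding alphat using lam2[of j] by (simp add: field_simps)
  qed (simp_all add: betat vectors at0 bt0)
  ultimately show ?thesis
    unfolding e0 c0 ct0 a0 at0 by linarith
qed

end
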